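(* Let $P$ be a probability measure on $\mathcal{X}(G)$, let $i\in G$, and suppose there is a constant $\kappa_{\min}>0$ such that, for all finite subsets $V$ of $G$, $$\kappa_{\min}\left\|P_{i|G}-P_{i|V}\right\|_\infty\le\left\|P_{i|G}\right\|_\infty-\left\|P_{i|V}\right\|_\infty .$$ Let $n\ge2$ and let $X_1,\dots,X_n$ be i.i.d. with law $P$. Let $\mathcal{G}_n$ be a finite collection of finite subsets of $G$, possibly random, and let $N_n$ be an almost sure bound on the cardinality of $\mathcal{G}_n$. Let $C>c_2$ and $\delta>1$, and for $V\in\mathcal{G}_n$ let $\mathrm{pen}(V)$ satisfy $$\mathrm{pen}(V)\ge\sqrt{\frac{\ln(\delta nN_n)}{n\,\widehat p_-^V}} .$$ Let $$\hat G_\delta(C)\in\operatorname*{arg\,min}_{V\in\mathcal{G}_n}\left\{-\left\|\widehat P_{i|V}\right\|_\infty+C\,\mathrm{pen}(V)\right\}.$$ Then there exists a positive constant $K=K(c_2,C,\kappa_{\min})$, depending only on $c_2$, $C$, $\kappa_{\min}$, such that $$P\left(\left\|\widehat P_{i|\hat G_\delta(C)}-P_{i|G}\right\|_\infty\le K\inf_{V\in\mathcal{G}_n}\left\{\left\|P_{i|G}-P_{i|V}\right\|_\infty+\mathrm{pen}(V)\right\}\right)\ge1-\frac1\delta .$$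
   Context: $G$ is a discrete set of sites (possibly infinite), $A=\{-1,1\}$, and for $V\subset G$, $\mathcal{X}(V)=A^V$. For $x\in\mathcal{X}(G)$ write $x(V)=(x(j))_{j\in V}$. For a probability measure $Q$, $Q(x(V))$ denotes the $Q$-probability that the configuration restricted to $V$ equals $x(V)$, and $Q_{i|V}(x)=Q(x(i)\mid x(V\setminus\{i\}))$ is a regular version of the conditional probability that the spin at $i$ equals $x(i)$ given that the configuration on $V\setminus\{i\}$ is $x(V\setminus\{i\})$; by convention, if $V$ is finite and $Q(x(V\setminus\{i\}))=0$, then $Q_{i|V}(x)=1/2$. $\|f\|_\infty=\sup_{x\in\mathcal{X}(G)}|f(x)|$. The empirical measure is $\widehat P(x)=\frac1n\sum_{k=1}^n\mathbf 1_{\{X_k=x\}}$, so that $\widehat P(x(V))=\frac1n\#\{k:X_k(V)=x(V)\}$. For finite $V$, $\widehat p_-^V=n^{-1}\vee\inf_{x\in\mathcal{X}(V)}\widehat P(x(V\setminus\{i\}))$. The outer $P$ denotes probability with respect to the sample. $c_2\le400$ is a fixed absolute constant such that, for every probability measure $P$ on $\mathcal{X}(G)$, every finite $V\subset G$, every $n\ge2$ and every $\delta>1$, $P\big(\|\widehat P_{i|V}-P_{i|V}\|_\infty>c_2\sqrt{\ln(\delta n)/(n\widehat p_-^V)}\big)\le1/\delta$.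
   Formalization: The collection must lie in a countably valued random collection independent of the sample, whose cardinality N_n bounds; for arbitrary sample-dependent collections the claim is false. Formally K is chosen once the ambient types of sites and sample space are fixed. *)

theory Defs
  imports "HOL-Probability.Probability"
begin

text \<open>The alphabet \<open>{-1, 1}\<close> is a set of integers; a configuration on \<open>V\<close> is an
  extensional function, so \<open>restrict x V\<close> is the restriction \<open>x(V)\<close>.\<close>

definition configs :: "'g set \<Rightarrow> ('g \<Rightarrow> int) set" where
  "configs V = (\<Pi>\<^sub>E j\<in>V. {-1, 1})"

definition config_space :: "'g set \<Rightarrow> ('g \<Rightarrow> int) measure" where
  "config_space V = (\<Pi>\<^sub>M j\<in>V. count_space {-1, 1})"

definition random_field :: "'g set \<Rightarrow> ('g \<Rightarrow> int) measure \<Rightarrow> bool" where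
  "random_field G Q \<longleftrightarrow> prob_space Q \<and> sets Q = sets (config_space G)"

text \<open>\<open>marg Q V x\<close> is \<open>Q(x(V))\<close>. It is used for finite \<open>V\<close> only, so the event is measurable.\<close>

definition marg :: "('g \<Rightarrow> int) measure \<Rightarrow> 'g set \<Rightarrow> ('g \<Rightarrow> int) \<Rightarrow> real" where
  "marg Q V x = measure Q {y \<in> space Q. \<forall>j\<in>V. y j = x j}"

text \<open>\<open>Q\<^sub>i\<^sub>|\<^sub>V\<close> for finite \<open>V\<close> is an elementary conditional probability. The site \<open>i\<close>
  need not belong to \<open>V\<close>, whence \<open>insert i V\<close>.\<close>

definition spec :: "('g \<Rightarrow> int) measure \<Rightarrow> 'g \<Rightarrow> 'g set \<Rightarrow> ('g \<Rightarrow> int) \<Rightarrow> real" where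
  "spec Q i V x =
     (if marg Q (V - {i}) x = 0 then 1/2 else marg Q (insert i V) x / marg Q (V - {i}) x)"

text \<open>The \<open>\<sigma>\<close>-algebra on \<open>\<X>(G)\<close> generated by the coordinates in \<open>W \<subseteq> G\<close>.\<close>

definition coord_algebra :: "'g set \<Rightarrow> 'g set \<Rightarrow> ('g \<Rightarrow> int) measure" where
  "coord_algebra G W = vimage_algebra (configs G) (\<lambda>x. restrict x W) (config_space W)"

text \<open>\<open>f\<close> is a regular version of \<open>x \<mapsto> Q(x(i) | x(V \ {i}))\<close>: for each \<open>x\<close> the map
  \<open>a \<mapsto> f (x(i := a))\<close> is a probability mass function on the spins, it depends measurably on
  \<open>x(V \ {i})\<close> only, and it is a conditional probability of the event that the spin at \<open>i\<close>
  equals \<open>a\<close>. The last conjunct fixes the version on null configurations when \<open>V\<close> is finite;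
  for infinite \<open>V\<close> any regular version is allowed.\<close>

definition spec_version ::
    "'g set \<Rightarrow> ('g \<Rightarrow> int) measure \<Rightarrow> 'g \<Rightarrow> 'g set \<Rightarrow> (('g \<Rightarrow> int) \<Rightarrow> real) \<Rightarrow> bool" where
  "spec_version G Q i V f \<longleftrightarrow>
     (\<forall>x\<in>configs G. 0 \<le> f x \<and> f (x(i := 1)) + f (x(i := -1)) = 1) \<and>
     (\<forall>a\<in>{-1, 1}.
        (\<lambda>x. f (x(i := a))) \<in> borel_measurable (coord_algebra G (V - {i})) \<and>
        (AE x in Q. f (x(i := a)) =
           real_cond_exp Q (coord_algebra G (V - {i})) (indicator {y \<in> space Q. y i = a}) x)) \<and>
     (finite V \<longrightarrow> (\<forall>x\<in>configs G. marg Q (V - {i}) x = 0 \<longrightarrow> f x = 1/2))"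

definition supnorm :: "'g set \<Rightarrow> (('g \<Rightarrow> int) \<Rightarrow> real) \<Rightarrow> real" where
  "supnorm G f = (SUP x\<in>configs G. \<bar>f x\<bar>)"

text \<open>The empirical measure of \<open>X 1, \<dots>, X n\<close>, as a measure on the configuration space.\<close>

definition emp :: "'g set \<Rightarrow> nat \<Rightarrow> (nat \<Rightarrow> 'g \<Rightarrow> int) \<Rightarrow> ('g \<Rightarrow> int) measure" where
  "emp G n X = distr (uniform_count_measure {1..n}) (config_space G) X"

lemma marg_emp:
  assumes X: "\<And>k. k \<in> {1..n} \<Longrightarrow> X k \<in> configs G"
    and V: "finite V" "V \<subseteq> G" and n: "n \<ge> 1"
  shows "marg (emp G n X) V x = card {k \<in> {1..n}. \<forall>j\<in>V. X k j = x j} / n"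
proof -
  let ?A = "{y \<in> space (config_space G). \<forall>j\<in>V. y j = x j}"
  have sp: "space (config_space G) = configs G"
    by (simp add: config_space_def configs_def space_PiM)
  have m: "X \<in> measurable (uniform_count_measure {1..n}) (config_space G)"
    using X by (auto simp: measurable_def sp space_uniform_count_measure sets_uniform_count_measure)
  have j: "{y \<in> space (config_space G). y j = x j} \<in> sets (config_space G)" if "j \<in> V" for j
  proof -
    have "(\<lambda>y. y j) \<in> measurable (config_space G) (count_space {-1, 1})"
      unfolding config_space_def using that V by (intro measurable_component_singleton) auto
    from measurable_sets[OF this, of "{x j} \<inter> {-1, 1}"]
    have "(\<lambda>y. y j) -` ({x j} \<inter> {-1, 1}) \<inter> space (config_space G) \<in> sets (config_space G)"
      by simp
    also have "(\<lambda>y. y j) -` ({x j} \<inter> {-1, 1}) \<inter> space (config_space G)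
        = {y \<in> space (config_space G). y j = x j}"
      using that V by (fastforce simp: sp configs_def PiE_iff)
    finally show ?thesis .
  qed
  have A: "?A \<in> sets (config_space G)"
    by (rule sets.sets_Collect_finite_All) (use j V in auto)
  have "marg (emp G n X) V x = measure (uniform_count_measure {1..n})
      (X -` ?A \<inter> space (uniform_count_measure {1..n}))"
    unfolding marg_def emp_def space_distr by (rule measure_distr[OF m A])
  also have "X -` ?A \<inter> space (uniform_count_measure {1..n}) = {k \<in> {1..n}. \<forall>j\<in>V. X k j = x j}"
    using X by (auto simp: space_uniform_count_measure sp)
  also have "measure (uniform_count_measure {1..n}) \<dots> = card {k \<in> {1..n}. \<forall>j\<in>V. X k j = x j} / n"
    by (subst measure_uniform_count_measure) auto
  finally show ?thesis .
qed

definition phat_minus ::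
    "'g set \<Rightarrow> 'g \<Rightarrow> nat \<Rightarrow> (nat \<Rightarrow> 'g \<Rightarrow> int) \<Rightarrow> 'g set \<Rightarrow> real" where
  "phat_minus G i n X V = max (1 / n) (INF x\<in>configs V. marg (emp G n X) (V - {i}) x)"

text \<open>The defining property of the constant \<open>c\<^sub>2\<close>, on the sites \<open>G\<close>. The sample is the canonical
  one, distributed as the \<open>n\<close>-fold product of \<open>P\<close>; the event depends on the sample through its
  restriction to finitely many sites, hence is measurable.\<close>

definition concentration_constant :: "'g set \<Rightarrow> real \<Rightarrow> bool" where
  "concentration_constant G c \<longleftrightarrow> c \<le> 400 \<and>
     (\<forall>P i V n \<delta>. random_field G P \<and> i \<in> G \<and> finite V \<and> V \<subseteq> G \<and> 2 \<le> n \<and> 1 < \<delta> \<longrightarrow>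
        measure (\<Pi>\<^sub>M k\<in>{1..n}. P)
          {X \<in> space (\<Pi>\<^sub>M k\<in>{1..n}. P).
             supnorm G (\<lambda>x. spec (emp G n X) i V x - spec P i V x)
               > c * sqrt (ln (\<delta> * n) / (n * phat_minus G i n X V))}
          \<le> 1 / \<delta>)"

definition iid_sample ::
    "'w measure \<Rightarrow> nat \<Rightarrow> 'g set \<Rightarrow> ('g \<Rightarrow> int) measure \<Rightarrow> (nat \<Rightarrow> 'w \<Rightarrow> 'g \<Rightarrow> int) \<Rightarrow> bool" where
  "iid_sample M n G P X \<longleftrightarrow>
     prob_space.indep_vars M (\<lambda>k. config_space G) X {1..n} \<and>
     (\<forall>k\<in>{1..n}. distr M (config_space G) (X k) = P)"

text \<open>A possibly random finite collection \<open>\<G>\<close> of finite subsets of \<open>G\<close>, with an almost sure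
  bound \<open>N\<close> on its cardinality. The collection may be selected from the sample, but the bound
  must then count the candidates it is selected from: some random collection \<open>\<C> \<supseteq> \<G>\<close>, drawn
  independently of the sample, has at most \<open>N\<close> members almost surely. With \<open>\<C> = \<G>\<close> this covers
  deterministic collections and random ones independent of the sample; with \<open>\<C>\<close> deterministic
  it covers arbitrary data-driven subcollections of a fixed family.

  Independence cannot be dropped altogether. For independent fair spins on an infinite \<open>G\<close>,
  there is almost surely a site \<open>j\<close> whose spin agrees with that at \<open>i\<close> throughout the sample,
  and for \<open>\<G> = {{i, j}}\<close>, \<open>N = 1\<close> and the smallest penalty, the oracle inequality
  fails for every \<open>K\<close> with probability tending to \<open>1\<close> as \<open>n \<rightarrow> \<infinity>\<close>.

  \<open>\<C>\<close> is a discrete random element; countability of its range is automatic if \<open>G\<close> is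
  countable.\<close>

definition random_collection ::
    "'w measure \<Rightarrow> nat \<Rightarrow> 'g set \<Rightarrow> (nat \<Rightarrow> 'w \<Rightarrow> 'g \<Rightarrow> int) \<Rightarrow> ('w \<Rightarrow> 'g set set) \<Rightarrow> real \<Rightarrow> bool" where
  "random_collection M n G X \<G> N \<longleftrightarrow>
     (\<exists>\<C>. (\<forall>\<omega>\<in>space M. finite (\<C> \<omega>) \<and> (\<forall>V\<in>\<C> \<omega>. finite V \<and> V \<subseteq> G) \<and> \<G> \<omega> \<subseteq> \<C> \<omega>) \<and>
        countable (\<C> ` space M) \<and>
        prob_space.indep_set M
          (sets (vimage_algebra (space M) \<C> (count_space UNIV)))
          (sets (vimage_algebra (space M) (\<lambda>\<omega>. \<lambda>k\<in>{1..n}. X k \<omega>)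
             (\<Pi>\<^sub>M k\<in>{1..n}. config_space G))) \<and>
        (AE \<omega> in M. real (card (\<C> \<omega>)) \<le> N))"

end

theory Submission
  imports Defs
begin

text \<open>Write \<open>\<parallel>\<cdot>\<parallel>\<close> for the supremum norm, \<open>D(V) = \<parallel>P\<^sub>i\<^sub>|\<^sub>G - P\<^sub>i\<^sub>|\<^sub>V\<parallel>\<close> for the bias of
  \<open>V\<close>, and \<open>W\<close> for the selected set. The theorem splits into a deterministic inequality, valid
  whenever every \<open>V\<close> in the collection satisfies
  \<open>\<parallel>\<close>empirical \<open>- P\<^sub>i\<^sub>|\<^sub>V\<parallel> \<le> c\<^sub>2 pen(V)\<close>, and a union bound giving this simultaneous control
  with probability at least \<open>1 - 1 / \<delta>\<close>.

  For the deterministic part (\<open>penalized_selection_oracle_inequality\<close>), replace the empirical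
  norms in the minimality of \<open>W\<close> by the true ones. This costs \<open>c\<^sub>2 pen\<close> on each side, and
  after adding \<open>\<parallel>P\<^sub>i\<^sub>|\<^sub>G\<parallel>\<close> it gives, for all \<open>V\<close>,
  \<open>(\<parallel>P\<^sub>i\<^sub>|\<^sub>G\<parallel> - \<parallel>P\<^sub>i\<^sub>|\<^sub>W\<parallel>) + (C - c\<^sub>2) pen(W)
     \<le> (\<parallel>P\<^sub>i\<^sub>|\<^sub>G\<parallel> - \<parallel>P\<^sub>i\<^sub>|\<^sub>V\<parallel>) + (C + c\<^sub>2) pen(V)\<close>.
  The norm gap on the left is at least \<open>\<kappa> D(W)\<close> by hypothesis, and the one on the right is at
  most \<open>D(V)\<close> by the triangle inequality. Since \<open>C > c\<^sub>2\<close>, both \<open>D(W)\<close> and \<open>pen(W)\<close>, hence the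
  error \<open>D(W) + c\<^sub>2 pen(W)\<close>, are bounded by a multiple of \<open>D(V) + pen(V)\<close>.

  For the union bound, the concentration inequality is applied at level \<open>\<delta> N\<close>, so that each
  fixed set fails with probability at most \<open>1 / (\<delta> N)\<close>. The collection is random, but it lies
  in one that is independent of the sample and takes countably many values; conditionally on
  almost every value, at most \<open>N\<close> sets are involved (\<open>indep_random_union_bound\<close>). Splitting the
  probability in this way requires the failure events to be measurable. They are, although a
  supremum over the possibly uncountable configuration space occurs in them, because only the
  finitely many coordinates in \<open>V \<union> {i}\<close> matter (\<open>finite_dependence_event_sets\<close>).\<close>

section \<open>Specifications of random fields\<close>

lemma space_config_space: "space (config_space G) = configs G"
  by (simp add: config_space_def configs_def space_PiM)

lemma configs_nonempty: "configs G \<noteq> {}"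
  by (auto simp: configs_def PiE_eq_empty_iff)

lemma finite_configs: "finite V \<Longrightarrow> finite (configs V)"
  by (auto simp: configs_def intro: finite_PiE)

lemma config_space_coordinate_event:
  assumes "j \<in> G"
  shows "{y \<in> space (config_space G). y j = a} \<in> sets (config_space G)"
proof -
  have "(\<lambda>y. y j) \<in> measurable (config_space G) (count_space {-1, 1})"
    unfolding config_space_def using assms by (intro measurable_component_singleton)
  from measurable_sets[OF this, of "{a} \<inter> {-1, 1}"]
  have "(\<lambda>y. y j) -` ({a} \<inter> {-1, 1}) \<inter> space (config_space G) \<in> sets (config_space G)"
    by simp
  also have "(\<lambda>y. y j) -` ({a} \<inter> {-1, 1}) \<inter> space (config_space G)
      = {y \<in> space (config_space G). y j = a}"
    using assms by (fastforce simp: space_config_space configs_def PiE_iff)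
  finally show ?thesis .
qed

lemma config_space_cylinder:
  assumes "finite V" "V \<subseteq> G"
  shows "{y \<in> space (config_space G). \<forall>j\<in>V. y j = x j} \<in> sets (config_space G)"
  by (rule sets.sets_Collect_finite_All)
     (use assms in \<open>auto intro: config_space_coordinate_event\<close>)

lemma random_field_space: "random_field G Q \<Longrightarrow> space Q = configs G"
  using sets_eq_imp_space_eq[of Q "config_space G"]
  by (simp add: random_field_def space_config_space)

lemma spec_unit_interval:
  assumes Q: "random_field G Q" and V: "finite V" "V \<subseteq> G"
  shows "spec Q i V x \<in> {0..1}"
proof -
  interpret prob_space Q using Q by (simp add: random_field_def)
  have sets: "sets Q = sets (config_space G)" using Q by (simp add: random_field_def)
  have "{y \<in> space Q. \<forall>j\<in>V - {i}. y j = x j} \<in> sets Q"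
    unfolding sets sets_eq_imp_space_eq[OF sets] using V by (intro config_space_cylinder) auto
  hence "marg Q (insert i V) x \<le> marg Q (V - {i}) x"
    unfolding marg_def by (intro finite_measure_mono) auto
  moreover have "0 \<le> marg Q (insert i V) x" by (simp add: marg_def)
  ultimately show ?thesis by (auto simp: spec_def divide_le_eq)
qed

text \<open>Any configuration is one of its own two modifications at \<open>i\<close>, whose values are nonnegative
  with sum one.\<close>

lemma spec_version_unit_interval:
  assumes f: "spec_version G Q i V f" and i: "i \<in> G" and x: "x \<in> configs G"
  shows "f x \<in> {0..1}"
proof -
  have sum: "f (x(i := 1)) + f (x(i := -1)) = 1" and nonneg: "0 \<le> f y" if "y \<in> configs G" for y
    using f x that by (auto simp: spec_version_def)
  have upd: "x(i := a) \<in> configs G" if "a \<in> {-1, 1}" for a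
    using x i that by (auto simp: configs_def PiE_iff extensional_def)
  have "x i \<in> {-1, 1}" using x i by (auto simp: configs_def)
  hence "x = x(i := 1) \<or> x = x(i := -1)" by auto
  moreover have "0 \<le> f (x(i := 1))" "0 \<le> f (x(i := -1))" using upd nonneg by auto
  ultimately have "f x \<le> 1" using sum[OF x] by (smt (verit))
  with nonneg[OF x] show ?thesis by simp
qed

lemma random_field_emp:
  assumes X: "\<And>k. k \<in> {1..n} \<Longrightarrow> X k \<in> configs G" and n: "1 \<le> n"
  shows "random_field G (emp G n X)"
proof -
  have "X \<in> measurable (uniform_count_measure {1..n}) (config_space G)"
    using X by (auto simp: measurable_def space_config_space space_uniform_count_measure
        sets_uniform_count_measure)
  moreover have "prob_space (uniform_count_measure {1..n})"
    using n by (intro prob_space_uniform_count_measure) auto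
  ultimately show ?thesis
    unfolding random_field_def emp_def by (auto intro: prob_space.prob_space_distr)
qed

section \<open>The supremum norm\<close>

text \<open>On \<open>real\<close> the supremum of an unbounded set is a junk value. Every function that occurs below
  takes values in \<open>{0..1}\<close>, and this is the form in which boundedness is carried along.\<close>

lemma supnorm_upper:
  assumes "\<And>y. y \<in> configs G \<Longrightarrow> \<bar>f y\<bar> \<le> B" "x \<in> configs G"
  shows "\<bar>f x\<bar> \<le> supnorm G f"
  unfolding supnorm_def using assms by (intro cSUP_upper) (auto simp: bdd_above_def)

lemma supnorm_least: "(\<And>x. x \<in> configs G \<Longrightarrow> \<bar>f x\<bar> \<le> B) \<Longrightarrow> supnorm G f \<le> B"
  unfolding supnorm_def by (intro cSUP_least configs_nonempty)

lemma supnorm_diff_commute: "supnorm G (\<lambda>x. f x - g x) = supnorm G (\<lambda>x. g x - f x)"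
  by (simp add: supnorm_def abs_minus_commute)

lemma supnorm_nonneg:
  assumes "\<And>y. y \<in> configs G \<Longrightarrow> \<bar>f y\<bar> \<le> B"
  shows "0 \<le> supnorm G f"
proof -
  obtain x where "x \<in> configs G" using configs_nonempty[of G] by auto
  from supnorm_upper[of G f, OF assms this] show ?thesis by linarith
qed

lemma supnorm_diff_triangle:
  assumes f: "\<And>x. x \<in> configs G \<Longrightarrow> f x \<in> {0..1}"
    and g: "\<And>x. x \<in> configs G \<Longrightarrow> g x \<in> {0..1}"
    and h: "\<And>x. x \<in> configs G \<Longrightarrow> h x \<in> {0..1::real}"
  shows "supnorm G (\<lambda>x. f x - h x)
           \<le> supnorm G (\<lambda>x. f x - g x) + supnorm G (\<lambda>x. g x - h x)"
proof (rule supnorm_least)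
  fix x assume x: "x \<in> configs G"
  have "\<bar>f x - g x\<bar> \<le> supnorm G (\<lambda>x. f x - g x)"
    by (rule supnorm_upper[where B = 1, OF _ x]) (use f g in \<open>fastforce simp: abs_le_iff\<close>)
  moreover have "\<bar>g x - h x\<bar> \<le> supnorm G (\<lambda>x. g x - h x)"
    by (rule supnorm_upper[where B = 1, OF _ x]) (use h g in \<open>fastforce simp: abs_le_iff\<close>)
  ultimately show "\<bar>f x - h x\<bar> \<le> supnorm G (\<lambda>x. f x - g x) + supnorm G (\<lambda>x. g x - h x)"
    by linarith
qed

lemma supnorm_diff_nonneg:
  assumes "\<And>x. x \<in> configs G \<Longrightarrow> f x \<in> {0..1}"
    and "\<And>x. x \<in> configs G \<Longrightarrow> g x \<in> {0..1::real}"
  shows "0 \<le> supnorm G (\<lambda>x. f x - g x)"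
  by (rule supnorm_nonneg[where B = 1]) (use assms in \<open>fastforce simp: abs_le_iff\<close>)

lemma supnorm_le_add_supnorm_diff:
  assumes "\<And>x. x \<in> configs G \<Longrightarrow> f x \<in> {0..1}"
    and "\<And>x. x \<in> configs G \<Longrightarrow> g x \<in> {0..1::real}"
  shows "supnorm G f \<le> supnorm G g + supnorm G (\<lambda>x. f x - g x)"
  using supnorm_diff_triangle[of G f g "\<lambda>_. 0"] assms by simp

section \<open>Measurability of the deviation event\<close>

text \<open>Samples restricted to the finite set \<open>W\<close> take finitely many values, so an event that only
  depends on the restriction is a finite union of cylinders.\<close>

lemma finite_dependence_event_sets:
  assumes W: "finite W" "W \<subseteq> G" and S: "sets P = sets (config_space G)"
    and F: "\<And>X X'. \<forall>k\<in>{1..n}. X k \<in> configs G \<Longrightarrow> \<forall>k\<in>{1..n}. X' k \<in> configs G \<Longrightarrow>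
        \<forall>k\<in>{1..n}. \<forall>j\<in>W. X k j = X' k j \<Longrightarrow> F X \<longleftrightarrow> F X'"
  shows "{X \<in> space (\<Pi>\<^sub>M k\<in>{1..n::nat}. P). F X} \<in> sets (\<Pi>\<^sub>M k\<in>{1..n}. P)"
proof -
  let ?S = "\<Pi>\<^sub>M k\<in>{1..n}. P"
  have sp: "space P = configs G" using sets_eq_imp_space_eq[OF S] by (simp add: space_config_space)
  have X: "X k \<in> configs G" if "X \<in> space ?S" "k \<in> {1..n}" for X k
    using that by (auto simp: space_PiM PiE_iff sp)
  let ?r = "\<lambda>X. \<lambda>k\<in>{1..n}. restrict (X k) W"
  \<comment> \<open>the restricted samples that are compatible with the event; each one gives a cylinder\<close>
  define A where "A = ?r ` {X \<in> space ?S. F X}"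
  have "A \<subseteq> (\<Pi>\<^sub>E k\<in>{1..n}. configs W)"
    using X W by (fastforce simp: A_def configs_def)
  hence fin: "finite A"
    by (rule finite_subset) (use W in \<open>auto intro: finite_PiE finite_configs\<close>)
  have cyl: "{X \<in> space ?S. \<forall>k\<in>{1..n}. \<forall>j\<in>W. X k j = a k j} \<in> sets ?S" for a
  proof (intro sets.sets_Collect_finite_All)
    fix k j assume k: "k \<in> {1..n}" and j: "j \<in> W"
    have "(\<lambda>X. X k) -` {y \<in> space P. y j = a k j} \<inter> space ?S \<in> sets ?S"
      by (rule measurable_sets[OF measurable_component_singleton[OF k]])
         (use config_space_coordinate_event[of j G] W j S sets_eq_imp_space_eq[OF S] in auto)
    also have "(\<lambda>X. X k) -` {y \<in> space P. y j = a k j} \<inter> space ?S = {X \<in> space ?S. X k j = a k j}"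
      using k by (auto simp: space_PiM)
    finally show "{X \<in> space ?S. X k j = a k j} \<in> sets ?S" .
  qed (use W in auto)
  have "{X \<in> space ?S. F X} = (\<Union>a\<in>A. {X \<in> space ?S. \<forall>k\<in>{1..n}. \<forall>j\<in>W. X k j = a k j})"
  proof (intro equalityI subsetI)
    fix Y assume "Y \<in> (\<Union>a\<in>A. {X \<in> space ?S. \<forall>k\<in>{1..n}. \<forall>j\<in>W. X k j = a k j})"
    then obtain Z where "Z \<in> space ?S" "F Z" and Y: "Y \<in> space ?S"
      and "\<forall>k\<in>{1..n}. \<forall>j\<in>W. Y k j = ?r Z k j"
      by (auto simp: A_def)
    with F[of Y Z] X show "Y \<in> {X \<in> space ?S. F X}" by auto
  next
    fix Y assume Y: "Y \<in> {X \<in> space ?S. F X}"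
    then show "Y \<in> (\<Union>a\<in>A. {X \<in> space ?S. \<forall>k\<in>{1..n}. \<forall>j\<in>W. X k j = a k j})"
      by (intro UN_I[of "?r Y"]) (auto simp: A_def)
  qed
  also have "\<dots> \<in> sets ?S" using fin cyl by (intro sets.finite_UN) auto
  finally show ?thesis .
qed

lemma marg_emp_cong:
  assumes "\<forall>k\<in>{1..n}. X k \<in> configs G" "\<forall>k\<in>{1..n}. X' k \<in> configs G"
    and "\<forall>k\<in>{1..n}. \<forall>j\<in>V. X k j = X' k j" and "finite V" "V \<subseteq> G" "1 \<le> n"
  shows "marg (emp G n X) V x = marg (emp G n X') V x"
proof -
  have "{k \<in> {1..n}. \<forall>j\<in>V. X k j = x j} = {k \<in> {1..n}. \<forall>j\<in>V. X' k j = x j}"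
    using assms(3) by auto
  thus ?thesis using assms marg_emp[of n X G V x] marg_emp[of n X' G V x] by simp
qed

text \<open>The factor that depends on the sample is kept apart in the denominator, so that the
  threshold \<open>r\<close> is a constant: \<open>r = c * sqrt (ln (\<delta> * n))\<close> gives the event of the concentration
  inequality.\<close>

definition deviates ::
    "'g set \<Rightarrow> ('g \<Rightarrow> int) measure \<Rightarrow> 'g \<Rightarrow> nat \<Rightarrow> real \<Rightarrow> 'g set \<Rightarrow> (nat \<Rightarrow> 'g \<Rightarrow> int) \<Rightarrow> bool" where
  "deviates G P i n r V X \<longleftrightarrow>
     supnorm G (\<lambda>x. spec (emp G n X) i V x - spec P i V x) > r / sqrt (n * phat_minus G i n X V)"

text \<open>The canonical sample is extensional on \<open>{1..n}\<close>, whereas a family of random variables is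
  indexed by all natural numbers; the empirical measure does not see the difference.\<close>

lemma emp_restrict: "emp G n (restrict X {1..n}) = emp G n X"
  unfolding emp_def by (rule distr_cong) (auto simp: space_uniform_count_measure)

lemma phat_minus_restrict: "phat_minus G i n (restrict X {1..n}) V = phat_minus G i n X V"
  by (simp only: phat_minus_def emp_restrict)

lemma deviates_sets:
  assumes "random_field G P" "finite V" "V \<subseteq> G" "i \<in> G" "1 \<le> n"
  shows "{X \<in> space (\<Pi>\<^sub>M k\<in>{1..n}. P). deviates G P i n r V X} \<in> sets (\<Pi>\<^sub>M k\<in>{1..n}. P)"
proof (rule finite_dependence_event_sets[where W = "insert i V" and G = G])
  fix X X' :: "nat \<Rightarrow> 'a \<Rightarrow> int"
  assume *: "\<forall>k\<in>{1..n}. X k \<in> configs G" "\<forall>k\<in>{1..n}. X' k \<in> configs G"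
    "\<forall>k\<in>{1..n}. \<forall>j\<in>insert i V. X k j = X' k j"
  have "marg (emp G n X) U x = marg (emp G n X') U x" if "U \<subseteq> insert i V" for U x
    using that assms * by (intro marg_emp_cong) (auto intro: finite_subset)
  hence "spec (emp G n X) i V = spec (emp G n X') i V"
    "phat_minus G i n X V = phat_minus G i n X' V"
    by (auto simp: spec_def phat_minus_def fun_eq_iff subset_insertI2 Diff_subset)
  thus "deviates G P i n r V X \<longleftrightarrow> deviates G P i n r V X'" by (simp add: deviates_def)
qed (use assms in \<open>auto simp: random_field_def\<close>)

lemma deviates_prob:
  assumes "concentration_constant G c" "random_field G P" "finite V" "V \<subseteq> G" "i \<in> G"
    "2 \<le> n" "1 < \<delta>"
  shows "measure (\<Pi>\<^sub>M k\<in>{1..n}. P)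
    {X \<in> space (\<Pi>\<^sub>M k\<in>{1..n}. P). deviates G P i n (c * sqrt (ln (\<delta> * n))) V X} \<le> 1 / \<delta>"
  using assms unfolding concentration_constant_def deviates_def
  by (simp add: real_sqrt_divide)

lemma phat_minus_pos: "1 \<le> n \<Longrightarrow> 0 < phat_minus G i n X V"
  by (simp add: phat_minus_def less_max_iff_disj)

text \<open>For \<open>c < 0\<close> the deviation event would be certain, since the threshold is negative. Even the
  empty set of sites then contradicts the bound \<open>1 / \<delta>\<close>. Nonnegativity is what lets the lower
  bound on the penalty be multiplied by \<open>c\<close>.\<close>

lemma concentration_constant_nonneg:
  assumes c: "concentration_constant G c" and P: "random_field G P" and i: "i \<in> G"
  shows "0 \<le> c"
proof (rule ccontr)
  assume neg: "\<not> 0 \<le> c"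
  let ?S = "\<Pi>\<^sub>M k\<in>{1..2::nat}. P"
  interpret S: prob_space ?S
    using P by (intro prob_space_PiM) (auto simp: random_field_def)
  have "deviates G P i 2 (c * sqrt (ln (2 * real 2))) {} X" if "X \<in> space ?S" for X
  proof -
    have "X k \<in> configs G" if "k \<in> {1..2}" for k
      using \<open>X \<in> space ?S\<close> that by (auto simp: space_PiM PiE_iff random_field_space[OF P])
    hence "random_field G (emp G 2 X)" by (intro random_field_emp) auto
    hence "0 \<le> supnorm G (\<lambda>x. spec (emp G 2 X) i {} x - spec P i {} x)"
      using P by (intro supnorm_diff_nonneg spec_unit_interval) auto
    moreover have "c * sqrt (ln (2 * 2)) / sqrt (2 * phat_minus G i 2 X {}) < 0"
      using neg phat_minus_pos[of 2 G i X "{}"] by (intro divide_neg_pos mult_neg_pos) auto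
    ultimately show ?thesis unfolding deviates_def by simp
  qed
  hence eq: "{X \<in> space ?S. deviates G P i 2 (c * sqrt (ln (2 * real 2))) {} X} = space ?S" by auto
  have "measure ?S {X \<in> space ?S. deviates G P i 2 (c * sqrt (ln (2 * real 2))) {} X} \<le> 1 / 2"
    using i by (intro deviates_prob[OF c P]) auto
  hence "measure ?S (space ?S) \<le> 1 / 2" by (simp only: eq)
  thus False unfolding S.prob_space by simp
qed

section \<open>A union bound over an independent random family\<close>

text \<open>On the event that \<open>\<C>\<close> equals a fixed family \<open>\<Gamma>\<close> with at most \<open>N\<close> members, independence
  leaves the law of \<open>T\<close> unchanged, so the ordinary union bound over \<open>\<Gamma>\<close> costs the factor \<open>N * p\<close>.
  Summing over the countably many values of \<open>\<C>\<close>, the probabilities of these disjoint events add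
  up to at most one.\<close>

lemma (in prob_space) indep_random_union_bound:
  assumes T: "T \<in> measurable M S"
    and fin: "\<And>\<omega>. \<omega> \<in> space M \<Longrightarrow> finite (\<C> \<omega>)"
    and cnt: "countable (\<C> ` space M)"
    and ind: "indep_set (sets (vimage_algebra (space M) \<C> (count_space UNIV)))
                (sets (vimage_algebra (space M) T S))"
    and card: "AE \<omega> in M. real (card (\<C> \<omega>)) \<le> N"
    and B: "\<And>\<omega> V. \<omega> \<in> space M \<Longrightarrow> V \<in> \<C> \<omega> \<Longrightarrow> B V \<in> sets S"
    and p: "0 \<le> p" "\<And>\<omega> V. \<omega> \<in> space M \<Longrightarrow> V \<in> \<C> \<omega> \<Longrightarrow> measure (distr M S T) (B V) \<le> p"
  shows "\<exists>E\<in>sets M. prob E \<ge> 1 - N * p \<and> (\<forall>\<omega>\<in>E. \<forall>V\<in>\<C> \<omega>. T \<omega> \<notin> B V)"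
proof -
  \<comment> \<open>the values of \<open>\<C>\<close> that respect the cardinality bound\<close>
  define R where "R = {\<Gamma> \<in> \<C> ` space M. real (card \<Gamma>) \<le> N}"
  have cR: "countable R" using cnt by (auto simp: R_def intro: countable_subset)
  have Rsub: "\<exists>\<omega>\<in>space M. \<Gamma> = \<C> \<omega>" and Rcard: "real (card \<Gamma>) \<le> N" if "\<Gamma> \<in> R" for \<Gamma>
    using that by (auto simp: R_def)
  let ?H = "\<lambda>\<Gamma>. \<C> -` {\<Gamma>} \<inter> space M"
  let ?D = "\<lambda>\<Gamma>. T -` (\<Union>V\<in>\<Gamma>. B V) \<inter> space M"
  have Hv: "\<C> -` Z \<inter> space M \<in> sets (vimage_algebra (space M) \<C> (count_space UNIV))" for Z
    by (rule in_vimage_algebra) simp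
  have ev: "sets (vimage_algebra (space M) \<C> (count_space UNIV)) \<subseteq> events"
    using ind by (auto simp: indep_set_def indep_sets_def UNIV_bool)
  have BU: "(\<Union>V\<in>\<Gamma>. B V) \<in> sets S" if "\<Gamma> \<in> R" for \<Gamma>
    using Rsub[OF that] fin B by (auto intro!: sets.finite_UN)
  have Dv: "?D \<Gamma> \<in> sets (vimage_algebra (space M) T S)" if "\<Gamma> \<in> R" for \<Gamma>
    by (rule in_vimage_algebra[OF BU[OF that]])
  have De: "?D \<Gamma> \<in> events" if "\<Gamma> \<in> R" for \<Gamma>
    by (rule measurable_sets[OF T BU[OF that]])
  have He: "?H \<Gamma> \<in> events" for \<Gamma> using Hv ev by blast
  have D_le: "prob (?D \<Gamma>) \<le> N * p" if \<Gamma>: "\<Gamma> \<in> R" for \<Gamma>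
  proof -
    obtain \<omega> where \<omega>: "\<omega> \<in> space M" "\<Gamma> = \<C> \<omega>" using Rsub[OF \<Gamma>] by auto
    have "?D \<Gamma> = (\<Union>V\<in>\<Gamma>. T -` B V \<inter> space M)" by auto
    also have "prob \<dots> \<le> (\<Sum>V\<in>\<Gamma>. prob (T -` B V \<inter> space M))"
      using \<omega> fin B by (intro finite_measure_subadditive_finite) (auto intro: measurable_sets[OF T])
    also have "\<dots> \<le> (\<Sum>V\<in>\<Gamma>. p)"
      using \<omega> p(2) B by (intro sum_mono) (metis measure_distr[OF T])
    also have "\<dots> \<le> N * p" using Rcard[OF \<Gamma>] p(1) by (simp add: mult_right_mono)
    finally show ?thesis .
  qed
  let ?U = "\<Union>\<Gamma>\<in>R. ?H \<Gamma> \<inter> ?D \<Gamma>"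
  have Ue: "?U \<in> events" using cR He De by (intro sets.countable_UN') auto
  have disj: "disjoint_family_on (\<lambda>\<Gamma>. ?H \<Gamma>) R" "disjoint_family_on (\<lambda>\<Gamma>. ?H \<Gamma> \<inter> ?D \<Gamma>) R"
    by (auto simp: disjoint_family_on_def)
  have N: "0 \<le> N"
  proof -
    have "AE \<omega> in M. 0 \<le> N" using card by eventually_elim linarith
    thus ?thesis by simp
  qed
  have "emeasure M ?U = (\<integral>\<^sup>+\<Gamma>. emeasure M (?H \<Gamma> \<inter> ?D \<Gamma>) \<partial>count_space R)"
    using cR He De disj by (intro emeasure_UN_countable) auto
  also have "\<dots> \<le> (\<integral>\<^sup>+\<Gamma>. ennreal (N * p) * emeasure M (?H \<Gamma>) \<partial>count_space R)"
  proof (rule nn_integral_mono)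
    fix \<Gamma> assume "\<Gamma> \<in> space (count_space R)"
    hence \<Gamma>: "\<Gamma> \<in> R" by simp
    have "prob (?H \<Gamma> \<inter> ?D \<Gamma>) = prob (?H \<Gamma>) * prob (?D \<Gamma>)"
      by (rule indep_setD[OF ind Hv Dv[OF \<Gamma>]])
    also have "\<dots> \<le> N * p * prob (?H \<Gamma>)"
      using D_le[OF \<Gamma>] by (metis mult.commute mult_right_mono measure_nonneg)
    finally show "emeasure M (?H \<Gamma> \<inter> ?D \<Gamma>) \<le> ennreal (N * p) * emeasure M (?H \<Gamma>)"
      using N p(1) by (simp add: emeasure_eq_measure ennreal_mult[symmetric] ennreal_leI)
  qed
  also have "\<dots> = ennreal (N * p) * (\<integral>\<^sup>+\<Gamma>. emeasure M (?H \<Gamma>) \<partial>count_space R)"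
    by (rule nn_integral_cmult) simp
  also have "(\<integral>\<^sup>+\<Gamma>. emeasure M (?H \<Gamma>) \<partial>count_space R) = emeasure M (\<Union>\<Gamma>\<in>R. ?H \<Gamma>)"
    using cR He disj by (intro emeasure_UN_countable[symmetric]) auto
  also have "ennreal (N * p) * \<dots> \<le> ennreal (N * p) * 1"
    by (intro mult_left_mono emeasure_le_1) auto
  finally have U_le: "prob ?U \<le> N * p"
    using N p(1) by (simp add: emeasure_eq_measure)
  let ?A = "\<C> -` {\<Gamma>. real (card \<Gamma>) \<le> N} \<inter> space M"
  have Ae: "?A \<in> events" using Hv ev by blast
  have A1: "prob ?A = 1"
    using card Ae by (subst prob_eq_1) auto
  have UA: "?U \<subseteq> ?A" by (auto dest: Rcard)
  show ?thesis
  proof (intro bexI[of _ "?A - ?U"] conjI ballI)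
    show "prob (?A - ?U) \<ge> 1 - N * p"
      using finite_measure_Diff[OF Ae Ue UA] A1 U_le by simp
    show "?A - ?U \<in> events" using Ae Ue by blast
  next
    fix \<omega> V assume "\<omega> \<in> ?A - ?U" and V: "V \<in> \<C> \<omega>"
    hence "\<omega> \<in> space M" "\<C> \<omega> \<in> R" "\<omega> \<notin> ?U" by (auto simp: R_def)
    thus "T \<omega> \<notin> B V" using V by blast
  qed
qed

section \<open>Penalised selection\<close>

definition oracle_factor :: "real \<Rightarrow> real \<Rightarrow> real \<Rightarrow> real" where
  "oracle_factor c C \<kappa> = (1 / \<kappa> + c / (C - c)) * (1 + C + c)"

lemma oracle_factor_pos: "0 \<le> c \<Longrightarrow> c < C \<Longrightarrow> 0 < \<kappa> \<Longrightarrow> 0 < oracle_factor c C \<kappa>"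
  unfolding oracle_factor_def by (intro mult_pos_pos add_pos_nonneg) auto

text \<open>Here \<open>app V\<close> is the approximation of the target \<open>f\<close> within the model \<open>V\<close>, and \<open>est V\<close> is an
  estimate of it. The assumption \<open>margin\<close> turns a comparison of norms into one of distances to
  \<open>f\<close>, and \<open>dev\<close> allows norms of estimates to be exchanged for norms of approximations. The penalty at the minimiser \<open>W\<close> has net weight \<open>C - c\<close>, which is positive, so a single
  inequality bounds both the bias and the penalty at \<open>W\<close>.\<close>

lemma penalized_selection_oracle_inequality:
  assumes c: "0 \<le> c" "c < C" "0 < \<kappa>"
    and f: "\<And>x. x \<in> configs G \<Longrightarrow> f x \<in> {0..1}"
    and app: "\<And>V x. V \<in> S \<Longrightarrow> x \<in> configs G \<Longrightarrow> app V x \<in> {0..1}"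
    and est: "\<And>V x. V \<in> S \<Longrightarrow> x \<in> configs G \<Longrightarrow> est V x \<in> {0..1}"
    and margin: "\<And>V. V \<in> S \<Longrightarrow>
      \<kappa> * supnorm G (\<lambda>x. f x - app V x) \<le> supnorm G f - supnorm G (app V)"
    and dev: "\<And>V. V \<in> S \<Longrightarrow> supnorm G (\<lambda>x. est V x - app V x) \<le> c * pen V"
    and pen: "\<And>V. V \<in> S \<Longrightarrow> 0 \<le> pen V"
    and sel: "is_arg_min (\<lambda>V. - supnorm G (est V) + C * pen V) (\<lambda>V. V \<in> S) W"
    and V: "V \<in> S"
  shows "supnorm G (\<lambda>x. est W x - f x)
           \<le> oracle_factor c C \<kappa> * (supnorm G (\<lambda>x. f x - app V x) + pen V)"
proof -
  let ?D = "\<lambda>V. supnorm G (\<lambda>x. f x - app V x)"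
  have W: "W \<in> S" using sel by (simp add: is_arg_min_def)
  have min: "- supnorm G (est W) + C * pen W \<le> - supnorm G (est V) + C * pen V"
    using sel V by (auto simp: is_arg_min_linorder)
  have D0: "0 \<le> ?D U" if "U \<in> S" for U
    using that f app by (intro supnorm_diff_nonneg) auto
  have up: "supnorm G (est W) \<le> supnorm G (app W) + c * pen W"
    using supnorm_le_add_supnorm_diff[of G "est W" "app W"] est[OF W] app[OF W] dev[OF W] by force
  have "supnorm G (app V) \<le> supnorm G (est V) + supnorm G (\<lambda>x. app V x - est V x)"
    using est[OF V] app[OF V] by (intro supnorm_le_add_supnorm_diff) auto
  hence low: "supnorm G (app V) \<le> supnorm G (est V) + c * pen V"
    using dev[OF V] supnorm_diff_commute[of G "app V" "est V"] by simp
  have bias: "supnorm G f - supnorm G (app V) \<le> ?D V"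
    using supnorm_le_add_supnorm_diff[of G f "app V"] f app[OF V] by force
  \<comment> \<open>one constant that dominates the coefficients \<open>1\<close> and \<open>C + c\<close> of the bias and the penalty\<close>
  define R where "R = (1 + C + c) * (?D V + pen V)"
  have "\<kappa> * ?D W + (C - c) * pen W \<le> ?D V + (C + c) * pen V"
    using margin[OF W] min up low bias by (simp add: algebra_simps)
  also have "\<dots> \<le> R"
    using D0[OF V] pen[OF V] c by (simp add: R_def algebra_simps add_increasing)
  finally have R: "\<kappa> * ?D W + (C - c) * pen W \<le> R" .
  have R1: "?D W \<le> R / \<kappa>"
    using R pen[OF W] c by (simp add: pos_le_divide_eq mult.commute)
      (smt (verit) mult_nonneg_nonneg)
  have "pen W \<le> R / (C - c)"
    using R D0[OF W] c by (simp add: pos_le_divide_eq mult.commute)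
      (smt (verit) mult_nonneg_nonneg)
  hence R2: "c * pen W \<le> c / (C - c) * R"
    using mult_left_mono[OF _ c(1)] by fastforce
  have "supnorm G (\<lambda>x. est W x - f x)
      \<le> supnorm G (\<lambda>x. est W x - app W x) + supnorm G (\<lambda>x. app W x - f x)"
    using est[OF W] app[OF W] f by (intro supnorm_diff_triangle) auto
  also have "\<dots> \<le> c * pen W + ?D W"
    using dev[OF W] supnorm_diff_commute[of G "app W" f] by simp
  also have "\<dots> \<le> (1 / \<kappa> + c / (C - c)) * R"
    using R1 R2 by (simp add: algebra_simps)
  finally show ?thesis by (simp add: oracle_factor_def R_def mult.assoc)
qed

section \<open>The oracle inequality\<close>

lemma iid_sample_distr:
  assumes "prob_space M" "iid_sample M n G P X" "1 \<le> n"
  defines "T \<equiv> \<lambda>\<omega>. \<lambda>k\<in>{1..n}. X k \<omega>"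
  shows "T \<in> measurable M (\<Pi>\<^sub>M k\<in>{1..n}. config_space G)"
    and "distr M (\<Pi>\<^sub>M k\<in>{1..n}. config_space G) T = (\<Pi>\<^sub>M k\<in>{1..n}. P)"
proof -
  interpret prob_space M by fact
  have rv: "random_variable (config_space G) (X k)" if "k \<in> {1..n}" for k
    using assms that by (auto simp: iid_sample_def indep_vars_def)
  show "T \<in> measurable M (\<Pi>\<^sub>M k\<in>{1..n}. config_space G)"
    unfolding T_def using rv by (rule measurable_restrict)
  have "distr M (\<Pi>\<^sub>M k\<in>{1..n}. config_space G) T
      = (\<Pi>\<^sub>M k\<in>{1..n}. distr M (config_space G) (X k))"
    unfolding T_def using assms rv
    by (subst indep_vars_iff_distr_eq_PiM'[symmetric]) (auto simp: iid_sample_def)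
  also have "\<dots> = (\<Pi>\<^sub>M k\<in>{1..n}. P)"
    using assms by (intro PiM_cong) (auto simp: iid_sample_def)
  finally show "distr M (\<Pi>\<^sub>M k\<in>{1..n}. config_space G) T = (\<Pi>\<^sub>M k\<in>{1..n}. P)" .
qed

text \<open>The concentration inequality at level \<open>\<delta> N\<close> puts the factor \<open>N\<close> inside the logarithm and
  makes the \<open>N\<close> failure probabilities add up to \<open>1 / \<delta>\<close>.\<close>

lemma uniform_deviation_over_random_collection:
  assumes c: "concentration_constant G c" and P: "random_field G P" and i: "i \<in> G" and n: "2 \<le> n"
    and M: "prob_space M" and X: "iid_sample M n G P X" and coll: "random_collection M n G X \<G> N"
    and N: "1 \<le> N" and \<delta>: "1 < \<delta>"
  shows "\<exists>E\<in>sets M. measure M E \<ge> 1 - 1 / \<delta> \<and> (\<forall>\<omega>\<in>E. \<forall>V\<in>\<G> \<omega>.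
           supnorm G (\<lambda>x. spec (emp G n (\<lambda>k. X k \<omega>)) i V x - spec P i V x)
             \<le> c * sqrt (ln (\<delta> * n * N) / (n * phat_minus G i n (\<lambda>k. X k \<omega>) V)))"
proof -
  interpret prob_space M by fact
  let ?S = "\<Pi>\<^sub>M k\<in>{1..n}. config_space G"
  let ?PS = "\<Pi>\<^sub>M k\<in>{1..n}. P"
  let ?T = "\<lambda>\<omega>. \<lambda>k\<in>{1..n}. X k \<omega>"
  let ?r = "c * sqrt (ln (\<delta> * N * n))"
  let ?B = "\<lambda>V. {Y \<in> space ?PS. deviates G P i n ?r V Y}"
  obtain \<C> where \<C>: "\<forall>\<omega>\<in>space M. finite (\<C> \<omega>) \<and> (\<forall>V\<in>\<C> \<omega>. finite V \<and> V \<subseteq> G) \<and> \<G> \<omega> \<subseteq> \<C> \<omega>"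
    and rest: "countable (\<C> ` space M)"
        "indep_set (sets (vimage_algebra (space M) \<C> (count_space UNIV)))
          (sets (vimage_algebra (space M) ?T ?S))"
        "AE \<omega> in M. real (card (\<C> \<omega>)) \<le> N"
    using coll unfolding random_collection_def by blast
  have \<C>V: "finite V" "V \<subseteq> G" if "\<omega> \<in> space M" "V \<in> \<C> \<omega>" for \<omega> V using \<C> that by auto
  have T: "?T \<in> measurable M ?S" and dT: "distr M ?S ?T = ?PS"
    using iid_sample_distr[OF M X] n by auto
  have sets: "sets ?PS = sets ?S" using dT by (metis sets_distr)
  have \<delta>N: "1 < \<delta> * N" using \<delta> N by (metis less_1_mult')
  have "\<exists>E\<in>sets M. prob E \<ge> 1 - N * (1 / (\<delta> * N)) \<and> (\<forall>\<omega>\<in>E. \<forall>V\<in>\<C> \<omega>. ?T \<omega> \<notin> ?B V)"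
  proof (rule indep_random_union_bound[OF T _ rest])
    show "?B V \<in> sets ?S" if "\<omega> \<in> space M" "V \<in> \<C> \<omega>" for \<omega> V
      using deviates_sets[OF P \<C>V[OF that] i, of n ?r] n unfolding sets by simp
    show "measure (distr M ?S ?T) (?B V) \<le> 1 / (\<delta> * N)" if "\<omega> \<in> space M" "V \<in> \<C> \<omega>" for \<omega> V
      unfolding dT by (rule deviates_prob[OF c P \<C>V[OF that] i n \<delta>N])
  qed (use \<C> \<delta>N in auto)
  then obtain E where E: "E \<in> sets M" "prob E \<ge> 1 - 1 / \<delta>"
    and good: "\<And>\<omega> V. \<omega> \<in> E \<Longrightarrow> V \<in> \<C> \<omega> \<Longrightarrow> ?T \<omega> \<notin> ?B V"
    using N by auto
  show ?thesis
  proof (intro bexI[of _ E] conjI ballI)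
    fix \<omega> V assume \<omega>: "\<omega> \<in> E" and V: "V \<in> \<G> \<omega>"
    have sp: "\<omega> \<in> space M" using \<omega> E sets.sets_into_space by auto
    have "?T \<omega> \<in> space ?PS"
      using measurable_space[OF T sp] sets_eq_imp_space_eq[OF sets] by simp
    hence "\<not> deviates G P i n ?r V (?T \<omega>)" using good[OF \<omega>, of V] \<C> sp V by auto
    moreover have "?T \<omega> = restrict (\<lambda>k. X k \<omega>) {1..n}" by simp
    ultimately have "supnorm G (\<lambda>x. spec (emp G n (\<lambda>k. X k \<omega>)) i V x - spec P i V x)
        \<le> ?r / sqrt (n * phat_minus G i n (\<lambda>k. X k \<omega>) V)"
      unfolding deviates_def emp_restrict phat_minus_restrict by (simp add: not_less)
    thus "supnorm G (\<lambda>x. spec (emp G n (\<lambda>k. X k \<omega>)) i V x - spec P i V x)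
        \<le> c * sqrt (ln (\<delta> * n * N) / (n * phat_minus G i n (\<lambda>k. X k \<omega>) V))"
      by (simp add: real_sqrt_divide mult_ac)
  qed (use E in auto)
qed

text \<open>A nonempty collection forces the almost sure bound to be at least one, and with it the
  logarithm \<open>ln (\<delta> * n * N)\<close> to be nonnegative: otherwise the level \<open>\<delta> * N\<close> might fall below one
  and the penalties might be negative.\<close>

lemma random_collection_bound_ge_1:
  assumes M: "prob_space M" and coll: "random_collection M n G X \<G> N"
    and ne: "\<And>\<omega>. \<omega> \<in> space M \<Longrightarrow> \<G> \<omega> \<noteq> {}"
  shows "1 \<le> N"
proof -
  interpret prob_space M by fact
  obtain \<C> where
    \<C>: "\<forall>\<omega>\<in>space M. finite (\<C> \<omega>) \<and> (\<forall>V\<in>\<C> \<omega>. finite V \<and> V \<subseteq> G) \<and> \<G> \<omega> \<subseteq> \<C> \<omega>"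
    and card: "AE \<omega> in M. real (card (\<C> \<omega>)) \<le> N"
    using coll unfolding random_collection_def by (elim exE conjE) (rule that)
  have "AE \<omega> in M. 1 \<le> N"
  proof (rule AE_mp[OF card], rule AE_I2, rule impI)
    fix \<omega> assume \<omega>: "\<omega> \<in> space M" and le: "real (card (\<C> \<omega>)) \<le> N"
    have "\<C> \<omega> \<noteq> {}" "finite (\<C> \<omega>)" using \<C> ne[OF \<omega>] \<omega> by auto
    hence "1 \<le> card (\<C> \<omega>)" by (simp add: Suc_le_eq card_gt_0_iff)
    thus "1 \<le> N" using le by linarith
  qed
  thus ?thesis by simp
qed

theorem theorem3p2:
  fixes c2 C \<kappa> :: real
  assumes "c2 < C" and "0 < \<kappa>"
  shows "\<exists>K>0. \<forall>(G :: 'g set) P i pG (M :: 'w measure) n X \<G> N \<delta> pen Ghat.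
    concentration_constant G c2 \<longrightarrow>
    random_field G P \<longrightarrow>
    i \<in> G \<longrightarrow>
    spec_version G P i G pG \<longrightarrow>
    (\<forall>V. finite V \<and> V \<subseteq> G \<longrightarrow>
       \<kappa> * supnorm G (\<lambda>x. pG x - spec P i V x) \<le> supnorm G pG - supnorm G (spec P i V)) \<longrightarrow>
    2 \<le> n \<longrightarrow>
    prob_space M \<longrightarrow>
    iid_sample M n G P X \<longrightarrow>
    random_collection M n G X \<G> N \<longrightarrow>
    1 < \<delta> \<longrightarrow>
    (\<forall>\<omega>\<in>space M. \<forall>V\<in>\<G> \<omega>.
       sqrt (ln (\<delta> * n * N) / (n * phat_minus G i n (\<lambda>k. X k \<omega>) V)) \<le> pen \<omega> V) \<longrightarrow>
    (\<forall>\<omega>\<in>space M.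
       is_arg_min (\<lambda>V. - supnorm G (spec (emp G n (\<lambda>k. X k \<omega>)) i V) + C * pen \<omega> V)
         (\<lambda>V. V \<in> \<G> \<omega>) (Ghat \<omega>)) \<longrightarrow>
    (\<exists>E\<in>sets M. measure M E \<ge> 1 - 1 / \<delta> \<and>
       (\<forall>\<omega>\<in>E.
          supnorm G (\<lambda>x. spec (emp G n (\<lambda>k. X k \<omega>)) i (Ghat \<omega>) x - pG x)
            \<le> K * (INF V\<in>\<G> \<omega>. supnorm G (\<lambda>x. pG x - spec P i V x) + pen \<omega> V)))"
proof -
  \<comment> \<open>\<open>K\<close> has to be fixed before \<open>G\<close> and \<open>P\<close>, hence before \<open>0 \<le> c2\<close> is known; for \<open>c2 < 0\<close>
    the concentration hypothesis cannot hold and any positive value will do\<close>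
  let ?K = "if 0 \<le> c2 then oracle_factor c2 C \<kappa> else 1"
  have K: "0 < ?K" using oracle_factor_pos assms by auto
  show ?thesis
  proof (rule exI[of _ ?K], rule conjI[OF K], intro allI impI)
    fix G :: "'g set" and P i pG and M :: "'w measure" and n X \<G> N \<delta> pen Ghat
    assume conc: "concentration_constant G c2"
      and P: "random_field G P" and i: "i \<in> G" and pG: "spec_version G P i G pG"
      and margin: "\<forall>V. finite V \<and> V \<subseteq> G \<longrightarrow>
       \<kappa> * supnorm G (\<lambda>x. pG x - spec P i V x) \<le> supnorm G pG - supnorm G (spec P i V)"
      and n: "2 \<le> n" and M: "prob_space M" and X: "iid_sample M n G P X"
      and coll: "random_collection M n G X \<G> N" and \<delta>: "1 < \<delta>"
      and pen: "\<forall>\<omega>\<in>space M. \<forall>V\<in>\<G> \<omega>.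
       sqrt (ln (\<delta> * n * N) / (n * phat_minus G i n (\<lambda>k. X k \<omega>) V)) \<le> pen \<omega> V"
      and sel: "\<forall>\<omega>\<in>space M.
       is_arg_min (\<lambda>V. - supnorm G (spec (emp G n (\<lambda>k. X k \<omega>)) i V) + C * pen \<omega> V)
         (\<lambda>V. V \<in> \<G> \<omega>) (Ghat \<omega>)"
    have c: "0 \<le> c2" by (rule concentration_constant_nonneg[OF conc P i])
    \<comment> \<open>the collections are nonempty because \<open>Ghat\<close> attains a minimum over them\<close>
    have nonempty: "\<G> \<omega> \<noteq> {}" if "\<omega> \<in> space M" for \<omega>
      using sel that by (auto simp: is_arg_min_def)
    have N: "1 \<le> N" by (rule random_collection_bound_ge_1[OF M coll nonempty])
    have finG: "finite V" "V \<subseteq> G" if "\<omega> \<in> space M" "V \<in> \<G> \<omega>" for \<omega> V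
      using coll that unfolding random_collection_def by (elim exE conjE; blast)+
    obtain E where E: "E \<in> sets M" "measure M E \<ge> 1 - 1 / \<delta>"
      and dev: "\<And>\<omega> V. \<omega> \<in> E \<Longrightarrow> V \<in> \<G> \<omega> \<Longrightarrow>
           supnorm G (\<lambda>x. spec (emp G n (\<lambda>k. X k \<omega>)) i V x - spec P i V x)
             \<le> c2 * sqrt (ln (\<delta> * n * N) / (n * phat_minus G i n (\<lambda>k. X k \<omega>) V))"
      using uniform_deviation_over_random_collection[OF conc P i n M X coll N \<delta>] by blast
    have "supnorm G (\<lambda>x. spec (emp G n (\<lambda>k. X k \<omega>)) i (Ghat \<omega>) x - pG x)
            \<le> ?K * (INF V\<in>\<G> \<omega>. supnorm G (\<lambda>x. pG x - spec P i V x) + pen \<omega> V)"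
      if \<omega>: "\<omega> \<in> E" for \<omega>
    proof -
      have sp: "\<omega> \<in> space M" using \<omega> E(1) sets.sets_into_space by auto
      let ?Q = "emp G n (\<lambda>k. X k \<omega>)"
      have "X k \<omega> \<in> configs G" if "k \<in> {1..n}" for k
        using measurable_space[OF iid_sample_distr(1)[OF M X] sp] n that
        by (auto simp: space_PiM PiE_iff space_config_space)
      hence Q: "random_field G ?Q" using n by (intro random_field_emp) auto
      have pen0: "0 \<le> pen \<omega> V" if V: "V \<in> \<G> \<omega>" for V
      proof -
        have "1 \<le> \<delta> * real n * N"
          using \<delta> n N by (intro mult_ge1_I) auto
        hence "0 \<le> sqrt (ln (\<delta> * n * N) / (n * phat_minus G i n (\<lambda>k. X k \<omega>) V))"
          using phat_minus_pos[of n G i "\<lambda>k. X k \<omega>" V] n by (intro real_sqrt_ge_zero divide_nonneg_nonneg) auto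
        thus ?thesis using pen sp V by (meson order_trans)
      qed
      have "supnorm G (\<lambda>x. spec ?Q i (Ghat \<omega>) x - pG x)
          \<le> oracle_factor c2 C \<kappa> * (supnorm G (\<lambda>x. pG x - spec P i V x) + pen \<omega> V)"
        if V: "V \<in> \<G> \<omega>" for V
      proof (rule penalized_selection_oracle_inequality[where S = "\<G> \<omega>"])
        fix U assume U: "U \<in> \<G> \<omega>"
        show "supnorm G (\<lambda>x. spec ?Q i U x - spec P i U x) \<le> c2 * pen \<omega> U"
          using dev[OF \<omega> U] mult_left_mono[OF pen[rule_format, OF sp U] c] by linarith
        show "\<kappa> * supnorm G (\<lambda>x. pG x - spec P i U x) \<le> supnorm G pG - supnorm G (spec P i U)"
          using margin finG[OF sp U] by blast
        show "spec P i U x \<in> {0..1}" "spec ?Q i U x \<in> {0..1}" for x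
          using spec_unit_interval[OF P finG[OF sp U]] spec_unit_interval[OF Q finG[OF sp U]] by blast+
        show "0 \<le> pen \<omega> U" by (rule pen0[OF U])
      next
        show "is_arg_min (\<lambda>V. - supnorm G (spec ?Q i V) + C * pen \<omega> V) (\<lambda>V. V \<in> \<G> \<omega>) (Ghat \<omega>)"
          using sel sp by blast
        show "pG x \<in> {0..1}" if "x \<in> configs G" for x
          by (rule spec_version_unit_interval[OF pG i that])
      qed (fact c assms V)+
      hence "supnorm G (\<lambda>x. spec ?Q i (Ghat \<omega>) x - pG x) / ?K
          \<le> (INF V\<in>\<G> \<omega>. supnorm G (\<lambda>x. pG x - spec P i V x) + pen \<omega> V)"
        using K c by (intro cINF_greatest nonempty[OF sp]) (auto simp: pos_divide_le_eq mult.commute)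
      thus ?thesis using K by (simp add: pos_divide_le_eq mult.commute split: if_splits)
    qed
    with E show "\<exists>E\<in>sets M. measure M E \<ge> 1 - 1 / \<delta> \<and>
       (\<forall>\<omega>\<in>E.
          supnorm G (\<lambda>x. spec (emp G n (\<lambda>k. X k \<omega>)) i (Ghat \<omega>) x - pG x)
            \<le> ?K * (INF V\<in>\<G> \<omega>. supnorm G (\<lambda>x. pG x - spec P i V x) + pen \<omega> V))"
      by blast
  qed
qed

end
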